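(* Let $\gamma>0$ and $-1\le\beta<0$. Let $\mathcal{X}=\{\mathcal{X}_n\}$ be a spike prior such that $\mathcal{X}_n$ is supported on at most $c^n$ points, for some fixed $c$. If $$(-\beta)+\log(1-(-\beta))<-2\gamma\log c$$ (with $\log0=-\infty$), then there is a (computationally inefficient) procedure that distinguishes between the spiked Wishart model $\mathrm{Wish}(\gamma,\beta,\mathcal{X})$ and the unspiked model $\mathrm{Wish}(\gamma)$ with $o(1)$ probability of error; that is, there is a sequence of tests, taking the observed matrix $Y$ as input, whose type I and type II error probabilities both tend to $0$ as $n\to\infty$.
   Context: A spike prior is a family $\mathcal{X}=\{\mathcal{X}_n\}$ with $\mathcal{X}_n$ a probability distribution on $\mathbb{R}^n$ such that $x^{(n)}\sim\mathcal{X}_n$ satisfies $\|x^{(n)}\|\to1$ in probability. The spiked Wishart model $\mathrm{Wish}(\gamma,\beta,\mathcal{X})$: draw $x\sim\mathcal{X}_n$ and reveal the $n\times n$ matrix $Y=XX^\top$, where $X$ is an $n\times N$ matrix whose columns are, conditionally on $x$, independent samples from $\mathcal{N}(0,I_n+\beta xx^\top)$; here $N=N(n)$ with $n/N\to\gamma$ as $n\to\infty$. It is assumed that $I_n+\beta xx^\top$ is positive semidefinite for all $x$ in the support of $\mathcal{X}_n$, so that the model is well defined. $\mathrm{Wish}(\gamma)$ is the unspiked case $\beta=0$ (same $N$). *)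

theory Defs
  imports "HOL-Probability.Probability"
begin

text \<open>
  Since the dimension $n$ varies, $\mathbf{R}^n$ is the product space over the index set
  \<open>{..<n}\<close>, and matrices are functions of two indices (or, as observations, points of the
  product space over pairs of indices).
\<close>

abbreviation rvec :: "nat \<Rightarrow> (nat \<Rightarrow> real) measure" where
  "rvec n \<equiv> PiM {..<n} (\<lambda>_. borel)"

abbreviation rmat :: "nat \<Rightarrow> (nat \<times> nat \<Rightarrow> real) measure" where
  "rmat n \<equiv> PiM ({..<n} \<times> {..<n}) (\<lambda>_. borel)"

abbreviation vnorm :: "nat \<Rightarrow> (nat \<Rightarrow> real) \<Rightarrow> real" where
  "vnorm n x \<equiv> L2_set x {..<n}"

definition psd :: "nat \<Rightarrow> (nat \<Rightarrow> nat \<Rightarrow> real) \<Rightarrow> bool" where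
  "psd n \<Sigma> \<longleftrightarrow> (\<forall>i<n. \<forall>j<n. \<Sigma> i j = \<Sigma> j i) \<and>
     (\<forall>v. (\<Sum>i<n. \<Sum>j<n. v i * \<Sigma> i j * v j) \<ge> 0)"

definition id_mat :: "nat \<Rightarrow> nat \<Rightarrow> real" where
  "id_mat i j = (if i = j then 1 else 0)"

definition spiked_cov :: "real \<Rightarrow> (nat \<Rightarrow> real) \<Rightarrow> nat \<Rightarrow> nat \<Rightarrow> real" where
  "spiked_cov \<beta> x i j = id_mat i j + \<beta> * x i * x j"

definition spike_prior :: "(nat \<Rightarrow> (nat \<Rightarrow> real) measure) \<Rightarrow> bool" where
  "spike_prior P \<longleftrightarrow>
     (\<forall>n. prob_space (P n) \<and> sets (P n) = sets (rvec n)) \<and>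
     (\<forall>\<epsilon>>0. (\<lambda>n. measure (P n) {x \<in> space (P n). \<bar>vnorm n x - 1\<bar> > \<epsilon>}) \<longlonglongrightarrow> 0)"

definition msupport :: "nat \<Rightarrow> (nat \<Rightarrow> real) measure \<Rightarrow> (nat \<Rightarrow> real) set" where
  "msupport n P = {x \<in> space P. \<forall>\<epsilon>>0. emeasure P {y \<in> space P. vnorm n (\<lambda>i. y i - x i) < \<epsilon>} > 0}"

text \<open>
  The law $N(0,\Sigma)$, as the law of $Az$ with $z$ standard Gaussian and $AA^T = \Sigma$;
  it does not depend on the choice of $A$, and $\Sigma$ may be singular (for instance if
  $\beta = -1$ and $|x| = 1$), in which case there is no density.  Meaningful only for
  positive semidefinite $\Sigma$.
\<close>

definition cov_factor :: "nat \<Rightarrow> (nat \<Rightarrow> nat \<Rightarrow> real) \<Rightarrow> nat \<Rightarrow> nat \<Rightarrow> real" where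
  "cov_factor n \<Sigma> = (SOME A. \<forall>i<n. \<forall>j<n. (\<Sum>k<n. A i k * A j k) = \<Sigma> i j)"

definition gaussian :: "nat \<Rightarrow> (nat \<Rightarrow> nat \<Rightarrow> real) \<Rightarrow> (nat \<Rightarrow> real) measure" where
  "gaussian n \<Sigma> = distr (PiM {..<n} (\<lambda>_. density lborel std_normal_density)) (rvec n)
     (\<lambda>z. \<lambda>i\<in>{..<n}. \<Sum>j<n. cov_factor n \<Sigma> i j * z j)"

text \<open>In \<open>gram n N X\<close>, \<open>X k\<close> is the \<open>k\<close>-th column of the $n \times N$ matrix $X$.\<close>

definition gram :: "nat \<Rightarrow> nat \<Rightarrow> (nat \<Rightarrow> nat \<Rightarrow> real) \<Rightarrow> (nat \<times> nat \<Rightarrow> real)" where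
  "gram n N X = (\<lambda>(i, j)\<in>{..<n} \<times> {..<n}. \<Sum>k<N. X k i * X k j)"

definition wishart :: "nat \<Rightarrow> nat \<Rightarrow> (nat \<Rightarrow> nat \<Rightarrow> real) \<Rightarrow> (nat \<times> nat \<Rightarrow> real) measure" where
  "wishart n N \<Sigma> = distr (PiM {..<N} (\<lambda>_. gaussian n \<Sigma>)) (rmat n) (gram n N)"

text \<open>
  The law on \<open>M\<close> of a sample from \<open>K x\<close> with \<open>x\<close> drawn from \<open>P\<close>.  This is used
  instead of \<open>bind\<close> because kernels are only required to behave well on the support of
  \<open>P\<close>, whereas \<open>bind\<close> needs them to be measurable on the whole space.
\<close>

definition mixture :: "'a measure \<Rightarrow> 'b measure \<Rightarrow> ('a \<Rightarrow> 'b measure) \<Rightarrow> 'b measure" where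
  "mixture P M K = measure_of (space M) (sets M) (\<lambda>A. \<integral>\<^sup>+ x. emeasure (K x) A \<partial>P)"

definition spiked_wishart ::
  "nat \<Rightarrow> nat \<Rightarrow> real \<Rightarrow> (nat \<Rightarrow> real) measure \<Rightarrow> (nat \<times> nat \<Rightarrow> real) measure" where
  "spiked_wishart n N \<beta> P = mixture P (rmat n) (\<lambda>x. wishart n N (spiked_cov \<beta> x))"

definition unspiked_wishart :: "nat \<Rightarrow> nat \<Rightarrow> (nat \<times> nat \<Rightarrow> real) measure" where
  "unspiked_wishart n N = wishart n N id_mat"

text \<open>Natural logarithm with the convention $\log 0 = -\infty$, used for arguments $\ge 0$.\<close>

definition elog :: "real \<Rightarrow> ereal" where
  "elog t = (if t = 0 then -\<infinity> else ereal (ln t))"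


subsection \<open>The laws are well defined\<close>

lemma cov_factor_spiked_cov:
  assumes "psd n (spiked_cov \<beta> x)" and i: "i < n" and j: "j < n"
  shows "(\<Sum>k<n. cov_factor n (spiked_cov \<beta> x) i k * cov_factor n (spiked_cov \<beta> x) j k)
    = spiked_cov \<beta> x i j"
proof -
  define r where "r = (\<Sum>k<n. x k * x k)"
  have r0: "r \<ge> 0" unfolding r_def by (intro sum_nonneg) auto
  have quad: "(\<Sum>i<n. \<Sum>j<n. x i * spiked_cov \<beta> x i j * x j) = r + \<beta> * r * r"
  proof -
    have "(\<Sum>j<n. x i * spiked_cov \<beta> x i j * x j) = x i * x i + \<beta> * (x i * x i) * r" if "i < n" for i
    proof -
      have "(\<Sum>j<n. x i * spiked_cov \<beta> x i j * x j)
          = (\<Sum>j<n. (if j = i then x i * x i else 0) + \<beta> * (x i * x i) * (x j * x j))"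
        by (intro sum.cong) (auto simp: spiked_cov_def id_mat_def algebra_simps)
      also have "\<dots> = x i * x i + \<beta> * (x i * x i) * r"
        using that by (simp add: sum.distrib r_def sum_distrib_left)
      finally show ?thesis .
    qed
    then have "(\<Sum>i<n. \<Sum>j<n. x i * spiked_cov \<beta> x i j * x j)
        = (\<Sum>i<n. x i * x i + \<beta> * r * (x i * x i))"
      by (intro sum.cong) (auto simp: algebra_simps)
    also have "\<dots> = r + \<beta> * r * r"
      by (simp add: sum.distrib r_def flip: sum_distrib_left)
    finally show ?thesis .
  qed
  have "(\<Sum>i<n. \<Sum>j<n. x i * spiked_cov \<beta> x i j * x j) \<ge> 0"
    using assms(1) unfolding psd_def by blast
  then have q0: "r * (1 + \<beta> * r) \<ge> 0" using quad by (simp add: algebra_simps)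
  define s where "s = (if r = 0 then \<beta> / 2 else (sqrt (1 + \<beta> * r) - 1) / r)"
  have s: "2 * s + s * s * r = \<beta>"
  proof (cases "r = 0")
    case False
    then have "r > 0" using r0 by simp
    then have "1 + \<beta> * r \<ge> 0" using q0 by (simp add: zero_le_mult_iff)
    then have "(1 + s * r) * (1 + s * r) = 1 + \<beta> * r"
      using False by (simp add: s_def)
    then have "r * (2 * s + s * s * r) = r * \<beta>" by (simp add: algebra_simps)
    then show ?thesis using False by (metis mult_left_cancel)
  qed (simp add: s_def)
  define A where "A = (\<lambda>i k. id_mat i k + s * x i * x k)"
  have "(\<Sum>k<n. A i k * A j k) = spiked_cov \<beta> x i j" if "i < n" "j < n" for i j
  proof -
    have "(\<Sum>k<n. A i k * A j k)
        = (\<Sum>k<n. (if k = i then id_mat i j + s * x i * x j else 0)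
             + (if k = j then s * x i * x j else 0) + s * s * (x i * x j) * (x k * x k))"
      by (intro sum.cong) (auto simp: A_def id_mat_def algebra_simps)
    also have "\<dots> = id_mat i j + s * x i * x j + s * x i * x j + s * s * (x i * x j) * r"
      using that by (simp add: sum.distrib r_def sum_distrib_left)
    also have "\<dots> = id_mat i j + (2 * s + s * s * r) * (x i * x j)"
      by (simp add: algebra_simps)
    finally show ?thesis by (simp add: s spiked_cov_def)
  qed
  then have "\<exists>A. \<forall>i<n. \<forall>j<n. (\<Sum>k<n. A i k * A j k) = spiked_cov \<beta> x i j" by blast
  then have "\<forall>i<n. \<forall>j<n. (\<Sum>k<n. cov_factor n (spiked_cov \<beta> x) i k * cov_factor n (spiked_cov \<beta> x) j k)
      = spiked_cov \<beta> x i j"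
    unfolding cov_factor_def by (rule someI_ex)
  then show ?thesis using i j by blast
qed

lemma sets_gaussian [simp, measurable_cong]: "sets (gaussian n \<Sigma>) = sets (rvec n)"
  by (simp add: gaussian_def)

lemma prob_space_gaussian: "prob_space (gaussian n \<Sigma>)"
proof -
  let ?M = "\<lambda>_::nat. density lborel std_normal_density"
  interpret product_prob_space ?M "{..<n}"
    by (intro product_prob_spaceI prob_space_normal_density) simp
  have [measurable_cong]: "sets (?M i) = sets borel" for i by simp
  show ?thesis unfolding gaussian_def
    by (rule P.prob_space_distr) measurable
qed

lemma sets_wishart [simp, measurable_cong]: "sets (wishart n N \<Sigma>) = sets (rmat n)"
  by (simp add: wishart_def)

lemma gram_measurable:
  "gram n N \<in> measurable (PiM {..<N} (\<lambda>_. gaussian n \<Sigma>)) (rmat n)"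
  unfolding gram_def
proof (rule measurable_restrict)
  fix p :: "nat \<times> nat" assume p: "p \<in> {..<n} \<times> {..<n}"
  have c: "(\<lambda>X. X k l) \<in> borel_measurable (PiM {..<N} (\<lambda>_. gaussian n \<Sigma>))"
    if "k < N" "l < n" for k l
  proof -
    have "(\<lambda>X. X k) \<in> measurable (PiM {..<N} (\<lambda>_. gaussian n \<Sigma>)) (gaussian n \<Sigma>)"
      using that by (intro measurable_component_singleton) simp
    moreover have "(\<lambda>v. v l) \<in> borel_measurable (gaussian n \<Sigma>)"
      using that by (simp add: measurable_cong_sets[OF sets_gaussian refl] measurable_component_singleton)
    ultimately show ?thesis by (rule measurable_compose)
  qed
  show "(\<lambda>X. case p of (i, j) \<Rightarrow> \<Sum>k<N. X k i * X k j)
      \<in> borel_measurable (PiM {..<N} (\<lambda>_. gaussian n \<Sigma>))"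
    using p by (auto intro!: borel_measurable_sum borel_measurable_times c)
qed

lemma prob_space_wishart: "prob_space (wishart n N \<Sigma>)"
proof -
  interpret product_prob_space "\<lambda>_::nat. gaussian n \<Sigma>" "{..<N}"
    by (intro product_prob_spaceI prob_space_gaussian)
  show ?thesis unfolding wishart_def
    by (rule P.prob_space_distr) (rule gram_measurable)
qed

lemma nn_integral_finite_support:
  assumes P: "prob_space P" and S: "finite S" "measure P S = 1" "\<And>s. s \<in> S \<Longrightarrow> {s} \<in> sets P"
  shows "(\<integral>\<^sup>+ x. f x \<partial>P) = (\<Sum>s\<in>S. f s * emeasure P {s})"
proof -
  interpret prob_space P by fact
  have SP: "S \<in> sets P" using S(2) measure_notin_sets by fastforce
  have "AE x in P. x \<in> S" using S(2) SP by (simp add: prob_eq_1)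
  then have "(\<integral>\<^sup>+ x. f x \<partial>P) = (\<integral>\<^sup>+ x. (\<Sum>s\<in>S. f s * indicator {s} x) \<partial>P)"
  proof (intro nn_integral_cong_AE, elim AE_mp, intro AE_I2 impI)
    fix x assume x: "x \<in> S"
    have "(\<Sum>s\<in>S. f s * indicator {s} x) = (\<Sum>s\<in>S. if s = x then f s else 0)"
      by (intro sum.cong) (auto simp: indicator_def)
    then show "f x = (\<Sum>s\<in>S. f s * indicator {s} x)" using x S(1) by simp
  qed
  also have "\<dots> = (\<Sum>s\<in>S. \<integral>\<^sup>+ x. f s * indicator {s} x \<partial>P)"
    using S(3) by (intro nn_integral_sum) auto
  also have "\<dots> = (\<Sum>s\<in>S. f s * emeasure P {s})"
    using S(3) by (intro sum.cong refl nn_integral_cmult_indicator) auto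
  finally show ?thesis .
qed

lemma sets_mixture [simp, measurable_cong]: "sets (mixture P M K) = sets M"
  unfolding mixture_def by (simp add: sets.space_closed sets.sigma_sets_eq)

lemma space_mixture [simp]: "space (mixture P M K) = space M"
  by (rule sets_eq_imp_space_eq) simp

lemma emeasure_mixture_finite_support:
  assumes P: "prob_space P" and S: "finite S" "measure P S = 1" "\<And>s. s \<in> S \<Longrightarrow> {s} \<in> sets P"
    and K: "\<And>x. sets (K x) = sets M" and A: "A \<in> sets M"
  shows "emeasure (mixture P M K) A = (\<Sum>s\<in>S. emeasure (K s) A * emeasure P {s})"
proof -
  have eq: "(\<integral>\<^sup>+ x. f x \<partial>P) = (\<Sum>s\<in>S. f s * emeasure P {s})" for f
    using P S by (rule nn_integral_finite_support)
  have "emeasure (mixture P M K) A = (\<integral>\<^sup>+ x. emeasure (K x) A \<partial>P)"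
  proof (rule emeasure_measure_of[OF mixture_def])
    show "sets M \<subseteq> Pow (space M)" by (rule sets.space_closed)
    show "A \<in> sets (mixture P M K)" using A by simp
    show "positive (sets (mixture P M K)) (\<lambda>A. \<integral>\<^sup>+ x. emeasure (K x) A \<partial>P)"
      by (simp add: positive_def)
    show "countably_additive (sets (mixture P M K)) (\<lambda>A. \<integral>\<^sup>+ x. emeasure (K x) A \<partial>P)"
    proof (rule countably_additiveI)
      fix B :: "nat \<Rightarrow> 'b set"
      assume B: "range B \<subseteq> sets (mixture P M K)" "disjoint_family B"
      have "(\<Sum>i. \<integral>\<^sup>+ x. emeasure (K x) (B i) \<partial>P)
          = (\<Sum>s\<in>S. \<Sum>i. emeasure (K s) (B i) * emeasure P {s})"
        unfolding eq by (intro suminf_sum) auto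
      also have "\<dots> = (\<Sum>s\<in>S. emeasure (K s) (\<Union>i. B i) * emeasure P {s})"
        using B K by (intro sum.cong) (auto simp: suminf_emeasure)
      finally show "(\<Sum>i. \<integral>\<^sup>+ x. emeasure (K x) (B i) \<partial>P) = (\<integral>\<^sup>+ x. emeasure (K x) (\<Union>i. B i) \<partial>P)"
        by (simp add: eq)
    qed
  qed
  then show ?thesis by (simp add: eq)
qed

lemma prob_space_mixture_finite_support:
  assumes P: "prob_space P" and S: "finite S" "measure P S = 1" "\<And>s. s \<in> S \<Longrightarrow> {s} \<in> sets P"
    and K: "\<And>x. sets (K x) = sets M" "\<And>x. prob_space (K x)"
  shows "prob_space (mixture P M K)"
proof (rule prob_spaceI)
  have "emeasure (K x) (space M) = 1" for x
    using prob_space.emeasure_space_1[OF K(2)] sets_eq_imp_space_eq[OF K(1)] by metis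
  then have "emeasure (mixture P M K) (space M) = (\<Sum>s\<in>S. 1 * emeasure P {s})"
    using emeasure_mixture_finite_support[where K = K and M = M, OF P S K(1)] by simp
  also have "\<dots> = (\<integral>\<^sup>+ x. 1 \<partial>P)"
    using P S by (rule nn_integral_finite_support[symmetric])
  also have "\<dots> = 1" using prob_space.emeasure_space_1[OF P] by simp
  finally show "emeasure (mixture P M K) (space (mixture P M K)) = 1" by simp
qed

end

theory Submission
  imports Defs
begin

text \<open>
  The test scans the points $x$ in the support of the prior with $|x|$ close to 1 and looks for
  one with $x^T Y x \le t N |x|^2$, where $1 + \beta < t < 1$.  In the unspiked model
  $x^T Y x / |x|^2$ is $\chi^2_N$ distributed, so that a Chernoff bound gives
  $e^{N (1 - t + \log t) / 2}$ for each $x$; for $t$ close to $1 + \beta$ the hypothesis makes this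
  beat the $c^n$ terms of the union bound.  In the spiked model the true spike $x$ makes
  $x^T Y x / |x|^2$ distributed as $(1 + \beta |x|^2) \chi^2_N$, which concentrates
  near $(1 + \beta) N < t N$.
\<close>

section \<open>Exponential moments of squared Gaussian linear forms\<close>

text \<open>Completing the exponent: the factor \<open>exp (l * z\<^sup>2)\<close> turns the density
  of variance \<sigma>^2 into 1/q times the density of variance \<sigma>^2/q^2, where q^2 = 1 - 2 l
  \<sigma>^2. The sign of \<open>l\<close> is free, so that both tails can be treated.\<close>

lemma nn_integral_exp_square_normal_density:
  assumes \<sigma>: "\<sigma> > 0" and l: "2 * l * \<sigma>\<^sup>2 < 1"
  shows "(\<integral>\<^sup>+z. ennreal (normal_density 0 \<sigma> z) * ennreal (exp (l * z\<^sup>2)) \<partial>lborel)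
    = ennreal (1 / sqrt (1 - 2 * l * \<sigma>\<^sup>2))"
proof -
  define q where "q = sqrt (1 - 2 * l * \<sigma>\<^sup>2)"
  define \<tau> where "\<tau> = \<sigma> / q"
  have q: "q > 0" "q\<^sup>2 = 1 - 2 * l * \<sigma>\<^sup>2" using l by (auto simp: q_def)
  have t: "\<tau> > 0" using q \<sigma> by (simp add: \<tau>_def)
  have t2: "\<tau>\<^sup>2 = \<sigma>\<^sup>2 / q\<^sup>2" by (simp add: \<tau>_def power_divide)
  have e: "- z\<^sup>2 / (2 * \<sigma>\<^sup>2) + l * z\<^sup>2 = - z\<^sup>2 / (2 * \<tau>\<^sup>2)" for z
  proof -
    have "- z\<^sup>2 / (2 * \<tau>\<^sup>2) = - z\<^sup>2 * (1 - 2 * l * \<sigma>\<^sup>2) / (2 * \<sigma>\<^sup>2)"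
      using q by (simp add: t2)
    then show ?thesis using \<sigma> by (simp add: field_simps)
  qed
  have c: "1 / sqrt (2 * pi * \<sigma>\<^sup>2) = 1 / q * (1 / sqrt (2 * pi * \<tau>\<^sup>2))"
    using \<sigma> q t by (simp add: real_sqrt_mult \<tau>_def)
  have "normal_density 0 \<sigma> z * exp (l * z\<^sup>2) = 1 / q * normal_density 0 \<tau> z" for z
  proof -
    have "normal_density 0 \<sigma> z * exp (l * z\<^sup>2)
        = 1 / sqrt (2 * pi * \<sigma>\<^sup>2) * exp (- z\<^sup>2 / (2 * \<sigma>\<^sup>2) + l * z\<^sup>2)"
      unfolding exp_add normal_density_def by simp
    then show ?thesis unfolding e c by (simp add: normal_density_def)
  qed
  then have "(\<integral>\<^sup>+z. ennreal (normal_density 0 \<sigma> z) * ennreal (exp (l * z\<^sup>2)) \<partial>lborel)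
      = (\<integral>\<^sup>+z. ennreal (1 / q) * ennreal (normal_density 0 \<tau> z) \<partial>lborel)"
    using q by (intro nn_integral_cong) (simp add: ennreal_mult[symmetric])
  also have "\<dots> = ennreal (1 / q) * (\<integral>\<^sup>+z. ennreal (normal_density 0 \<tau> z) \<partial>lborel)"
    by (rule nn_integral_cmult) simp
  also have "(\<integral>\<^sup>+z. ennreal (normal_density 0 \<tau> z) \<partial>lborel) = 1"
    using t by (simp add: nn_integral_eq_integral)
  finally show ?thesis by (simp add: q_def)
qed

text \<open>A linear form in independent standard normals is centred normal with variance the sum of
  the squared weights, which reduces the claim to the one-dimensional integral.\<close>

lemma nn_integral_exp_square_std_normal:
  fixes w :: "nat \<Rightarrow> real"
  assumes l: "2 * l * (\<Sum>j<n. (w j)\<^sup>2) < 1"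
  shows "(\<integral>\<^sup>+z. ennreal (exp (l * (\<Sum>j<n. w j * z j)\<^sup>2))
      \<partial>PiM {..<n} (\<lambda>_. density lborel std_normal_density))
    = ennreal (1 / sqrt (1 - 2 * l * (\<Sum>j<n. (w j)\<^sup>2)))"
proof -
  let ?D = "density lborel (\<lambda>x. ennreal (std_normal_density x))"
  let ?M = "PiM {..<n} (\<lambda>_. ?D)"
  \<comment> \<open>A term with weight 0 has no density, so only nonzero weights enter the sum of
    independent normals. If none remain, the linear form is 0 and both sides are 1.\<close>
  define J where "J = {j. j < n \<and> w j \<noteq> 0}"
  have J: "finite J" "J \<subseteq> {..<n}" by (auto simp: J_def)
  interpret product_prob_space "\<lambda>_::nat. ?D" "{..<n}"
    by (intro product_prob_spaceI prob_space_normal_density) simp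
  have [measurable_cong]: "sets ?D = sets borel" by simp
  have lin: "(\<Sum>j<n. w j * z j) = (\<Sum>j\<in>J. w j * z j)" for z
    using J by (intro sum.mono_neutral_right) (auto simp: J_def)
  have sq: "(\<Sum>j<n. (w j)\<^sup>2) = (\<Sum>j\<in>J. (w j)\<^sup>2)"
    using J by (intro sum.mono_neutral_right) (auto simp: J_def)
  show ?thesis
  proof (cases "J = {}")
    case True
    then show ?thesis unfolding lin sq using P.emeasure_space_1 by simp
  next
    case False
    have comp: "(\<lambda>z. z j) \<in> measurable ?M borel" if "j < n" for j
    proof -
      have "(\<lambda>z. z j) \<in> measurable ?M ?D"
        using that by (intro measurable_component_singleton) simp
      then show ?thesis by (simp add: measurable_cong_sets[OF refl, of ?D borel])
    qed
    have dist: "distr ?M borel (\<lambda>z. z j) = ?D" if "j < n" for j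
    proof -
      have "distr ?M borel (\<lambda>z. z j) = distr ?M ?D (\<lambda>z. z j)"
        by (rule distr_cong) auto
      then show ?thesis using PiM_component[of j] that by simp
    qed
    \<comment> \<open>Independence of the coordinates holds because their joint law is the product
      measure itself.\<close>
    have "P.indep_vars (\<lambda>_. borel) (\<lambda>j z. z j) {..<n}"
    proof (subst P.indep_vars_iff_distr_eq_PiM')
      show "{..<n} \<noteq> {}" using False J by auto
      have "distr ?M (PiM {..<n} (\<lambda>_. borel)) (\<lambda>z. \<lambda>i\<in>{..<n}. z i) = distr ?M ?M (\<lambda>z. z)"
        by (rule distr_cong) (auto simp: space_PiM PiE_iff extensional_restrict intro!: sets_PiM_cong)
      also have "\<dots> = ?M" by (simp add: distr_id)
      also have "\<dots> = PiM {..<n} (\<lambda>j. distr ?M borel (\<lambda>z. z j))"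
        by (intro PiM_cong) (auto simp: dist)
      finally show "distr ?M (PiM {..<n} (\<lambda>_. borel)) (\<lambda>z. \<lambda>i\<in>{..<n}. z i)
        = PiM {..<n} (\<lambda>j. distr ?M borel (\<lambda>z. z j))" .
    qed (use comp in auto)
    then have "P.indep_vars (\<lambda>_. borel) (\<lambda>j z. z j) J"
      using J by (rule_tac P.indep_vars_subset)
    then have ind: "P.indep_vars (\<lambda>_. borel) (\<lambda>j z. w j * z j) J"
      by (rule P.indep_vars_compose2) auto
    have nd: "distributed ?M lborel (\<lambda>z. w j * z j) (normal_density 0 \<bar>w j\<bar>)" if "j \<in> J" for j
    proof -
      have "distributed ?M lborel (\<lambda>z. z j) std_normal_density"
        unfolding distributed_def using that comp dist J
        by (auto simp: distr_cong[OF refl sets_lborel refl])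
      from P.normal_density_affine[OF this, of "w j" 0] that show ?thesis
        by (simp add: J_def)
    qed
    have "distributed ?M lborel (\<lambda>z. \<Sum>j\<in>J. w j * z j)
        (normal_density (\<Sum>j\<in>J. 0) (sqrt (\<Sum>j\<in>J. \<bar>w j\<bar>\<^sup>2)))"
      using J False ind nd by (intro P.sum_indep_normal) (auto simp: J_def)
    then have D: "distributed ?M lborel (\<lambda>z. \<Sum>j\<in>J. w j * z j)
        (normal_density 0 (sqrt (\<Sum>j\<in>J. (w j)\<^sup>2)))" by simp
    have pos: "(\<Sum>j\<in>J. (w j)\<^sup>2) > 0"
      using J False by (intro sum_pos) (auto simp: J_def)
    show ?thesis unfolding lin sq
      using distributed_nn_integral[OF D, of "\<lambda>y. ennreal (exp (l * y\<^sup>2))"]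
        nn_integral_exp_square_normal_density[of "sqrt (\<Sum>j\<in>J. (w j)\<^sup>2)" l] pos l
      by (simp add: sq)
  qed
qed

text \<open>The identity |A^T x|^2 = x^T (A A^T) x; it makes the variance of x^T A z depend on A A^T
  only.\<close>

lemma sum_square_eq_quadratic_form:
  fixes x :: "nat \<Rightarrow> real"
  shows "(\<Sum>j<n. (\<Sum>i<n. x i * A i j)\<^sup>2) = (\<Sum>i<n. \<Sum>k<n. x i * x k * (\<Sum>j<n. A i j * A k j))"
proof -
  have "(\<Sum>j<n. (\<Sum>i<n. x i * A i j)\<^sup>2) = (\<Sum>j<n. \<Sum>i<n. \<Sum>k<n. x i * x k * (A i j * A k j))"
    by (simp add: power2_eq_square sum_product mult_ac)
  also have "\<dots> = (\<Sum>i<n. \<Sum>j<n. \<Sum>k<n. x i * x k * (A i j * A k j))"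
    by (rule sum.swap)
  also have "\<dots> = (\<Sum>i<n. \<Sum>k<n. \<Sum>j<n. x i * x k * (A i j * A k j))"
    by (intro sum.cong refl sum.swap)
  finally show ?thesis by (simp add: sum_distrib_left)
qed

lemma spiked_cov_quadratic_form:
  "(\<Sum>i<n. \<Sum>k<n. x i * x k * spiked_cov \<beta> x i k) = (vnorm n x)\<^sup>2 + \<beta> * ((vnorm n x)\<^sup>2)\<^sup>2"
proof -
  have r: "(vnorm n x)\<^sup>2 = (\<Sum>i<n. (x i)\<^sup>2)"
    by (simp add: L2_set_def sum_nonneg)
  have "(\<Sum>i<n. \<Sum>k<n. x i * x k * spiked_cov \<beta> x i k)
      = (\<Sum>i<n. \<Sum>k<n. (if k = i then (x i)\<^sup>2 else 0) + \<beta> * ((x i)\<^sup>2 * (x k)\<^sup>2))"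
    by (intro sum.cong) (auto simp: spiked_cov_def id_mat_def algebra_simps power2_eq_square)
  also have "\<dots> = (\<Sum>i<n. (x i)\<^sup>2) + \<beta> * (\<Sum>i<n. \<Sum>k<n. (x i)\<^sup>2 * (x k)\<^sup>2)"
    by (simp add: sum.distrib sum_distrib_left)
  also have "(\<Sum>i<n. \<Sum>k<n. (x i)\<^sup>2 * (x k)\<^sup>2) = (\<Sum>i<n. (x i)\<^sup>2)\<^sup>2"
    by (simp add: power2_eq_square sum_product)
  finally show ?thesis by (simp add: r)
qed

text \<open>With y = A z, the form x^T y is a linear form in z with weights A^T x, and |A^T x|^2 =
  x^T \<Sigma> x = \<open>v\<close>. Only A A^T = \<Sigma> is used, so neither the choice of A nor a
  singular \<Sigma> matters.\<close>

lemma gaussian_exp_square: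
  assumes psd: "psd n (spiked_cov \<beta> x)"
    and v: "v = (vnorm n x)\<^sup>2 + \<beta> * ((vnorm n x)\<^sup>2)\<^sup>2" and l: "2 * l * v < 1"
  shows "(\<integral>\<^sup>+y. ennreal (exp (l * (\<Sum>i<n. x i * y i)\<^sup>2)) \<partial>gaussian n (spiked_cov \<beta> x))
    = ennreal (1 / sqrt (1 - 2 * l * v))"
proof -
  define A where "A = cov_factor n (spiked_cov \<beta> x)"
  let ?D = "density lborel (\<lambda>x. ennreal (std_normal_density x))"
  have [measurable_cong]: "sets ?D = sets borel" by simp
  define w where "w j = (\<Sum>i<n. x i * A i j)" for j
  have "(\<Sum>j<n. (w j)\<^sup>2) = (\<Sum>i<n. \<Sum>k<n. x i * x k * spiked_cov \<beta> x i k)"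
    unfolding w_def sum_square_eq_quadratic_form
    by (intro sum.cong refl) (simp add: A_def cov_factor_spiked_cov[OF psd])
  then have w: "(\<Sum>j<n. (w j)\<^sup>2) = v" by (simp only: v spiked_cov_quadratic_form)
  have lin: "(\<Sum>i<n. x i * (\<lambda>i\<in>{..<n}. \<Sum>j<n. A i j * z j) i) = (\<Sum>j<n. w j * z j)" for z
    by (simp add: w_def sum_distrib_left sum_distrib_right mult_ac) (rule sum.swap)
  have "(\<integral>\<^sup>+y. ennreal (exp (l * (\<Sum>i<n. x i * y i)\<^sup>2)) \<partial>gaussian n (spiked_cov \<beta> x))
    = (\<integral>\<^sup>+z. ennreal (exp (l * (\<Sum>j<n. w j * z j)\<^sup>2)) \<partial>PiM {..<n} (\<lambda>_. ?D))"
    unfolding gaussian_def A_def[symmetric]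
    by (subst nn_integral_distr) (simp_all only: lin, measurable)
  also have "\<dots> = ennreal (1 / sqrt (1 - 2 * l * v))"
    using nn_integral_exp_square_std_normal[of l w n] l by (simp add: w)
  finally show ?thesis .
qed

section \<open>Chernoff bounds for quadratic forms of Wishart matrices\<close>

text \<open>x^T X X^T x = |X^T x|^2: the test statistic is a sum of squares, one for each
  independent column.\<close>

lemma gram_quadratic_form:
  "(\<Sum>i<n. \<Sum>j<n. x i * gram n N X (i, j) * x j) = (\<Sum>k<N. (\<Sum>i<n. x i * X k i)\<^sup>2)"
proof -
  have "(\<Sum>i<n. \<Sum>j<n. x i * gram n N X (i, j) * x j)
      = (\<Sum>i<n. \<Sum>j<n. x i * x j * (\<Sum>k<N. X k i * X k j))"
    by (intro sum.cong) (auto simp: gram_def)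
  also have "\<dots> = (\<Sum>i<n. \<Sum>k<N. \<Sum>j<n. x i * x j * (X k i * X k j))"
    unfolding sum_distrib_left by (intro sum.cong refl sum.swap)
  also have "\<dots> = (\<Sum>k<N. \<Sum>i<n. \<Sum>j<n. x i * x j * (X k i * X k j))"
    by (rule sum.swap)
  finally show ?thesis by (simp add: power2_eq_square sum_product mult_ac)
qed

lemma quadratic_form_measurable [measurable]:
  "(\<lambda>Y. \<Sum>i<n. \<Sum>j<n. x i * Y (i, j) * x j) \<in> borel_measurable (rmat n)"
  by (intro borel_measurable_sum borel_measurable_times measurable_component_singleton) auto

text \<open>Exponential Markov inequality; by independence of the columns the moment is an
  \<open>N\<close>-th power. The event is written with the factor \<open>l\<close> so that l < 0
  gives a lower tail and l > 0 an upper tail.\<close>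

lemma wishart_chernoff:
  assumes psd: "psd n (spiked_cov \<beta> x)"
    and v: "v = (vnorm n x)\<^sup>2 + \<beta> * ((vnorm n x)\<^sup>2)\<^sup>2" and l: "2 * l * v < 1"
  shows "emeasure (wishart n N (spiked_cov \<beta> x))
      {Y \<in> space (rmat n). l * a \<le> l * (\<Sum>i<n. \<Sum>j<n. x i * Y (i, j) * x j)}
    \<le> ennreal (exp (- (l * a)) * (1 / sqrt (1 - 2 * l * v)) ^ N)" (is "emeasure ?W ?E \<le> _")
proof -
  let ?G = "gaussian n (spiked_cov \<beta> x)"
  let ?Q = "\<lambda>Y. \<Sum>i<n. \<Sum>j<n. x i * Y (i, j) * x j"
  interpret product_prob_space "\<lambda>_::nat. ?G" "{..<N}"
    by (intro product_prob_spaceI prob_space_gaussian)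
  have "emeasure ?W ?E = (\<integral>\<^sup>+Y. indicator ?E Y \<partial>?W)" by simp
  also have "\<dots> \<le> (\<integral>\<^sup>+Y. ennreal (exp (- (l * a))) * ennreal (exp (l * ?Q Y)) \<partial>?W)"
  proof (rule nn_integral_mono)
    fix Y
    show "indicator ?E Y \<le> ennreal (exp (- (l * a))) * ennreal (exp (l * ?Q Y))"
      by (auto simp: indicator_def ennreal_mult[symmetric] exp_add[symmetric])
  qed
  also have "\<dots> = ennreal (exp (- (l * a))) * (\<integral>\<^sup>+Y. ennreal (exp (l * ?Q Y)) \<partial>?W)"
    by (rule nn_integral_cmult) measurable
  also have "(\<integral>\<^sup>+Y. ennreal (exp (l * ?Q Y)) \<partial>?W)
      = (\<integral>\<^sup>+X. (\<Prod>k<N. ennreal (exp (l * (\<Sum>i<n. x i * X k i)\<^sup>2))) \<partial>PiM {..<N} (\<lambda>_. ?G))"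
    unfolding wishart_def
    by (subst nn_integral_distr[OF gram_measurable])
      (simp_all add: gram_quadratic_form sum_distrib_left exp_sum prod_ennreal)
  also have "\<dots> = (\<Prod>k<N. \<integral>\<^sup>+y. ennreal (exp (l * (\<Sum>i<n. x i * y i)\<^sup>2)) \<partial>?G)"
    by (rule product_nn_integral_prod) (simp, measurable)
  also have "\<dots> = ennreal ((1 / sqrt (1 - 2 * l * v)) ^ N)"
    using l by (simp add: gaussian_exp_square[OF psd v l] ennreal_power)
  also have "ennreal (exp (- (l * a))) * \<dots> = ennreal (exp (- (l * a)) * (1 / sqrt (1 - 2 * l * v)) ^ N)"
    by (rule ennreal_mult[symmetric]) (use l in auto)
  finally show ?thesis .
qed


text \<open>The Chernoff bound with \<beta> = 0, where the variance \<open>v\<close> is just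
  |x|^2.\<close>

lemma unspiked_lower_tail:
  assumes x: "vnorm n x > 0" and t: "0 < t" "t < 1"
  shows "emeasure (unspiked_wishart n N)
      {Y \<in> space (rmat n). (\<Sum>i<n. \<Sum>j<n. x i * Y (i, j) * x j) \<le> t * real N * (vnorm n x)\<^sup>2}
    \<le> ennreal (exp (real N / 2 * (1 - t + ln t)))"
proof -
  define r where "r = (vnorm n x)\<^sup>2"
  have r: "r > 0" using x by (simp add: r_def)
  \<comment> \<open>The minimizer of the Chernoff bound, determined by 1 - 2 l r = 1/t; it is
    negative since t < 1.\<close>
  define l where "l = - (1 / t - 1) / (2 * r)"
  have l0: "l < 0" using r t by (simp add: l_def divide_neg_pos)
  have lr: "2 * l * r = 1 - 1 / t" using r by (simp add: l_def)
  have cov: "spiked_cov 0 x = id_mat" by (intro ext) (simp add: spiked_cov_def)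
  have psd: "psd n (spiked_cov 0 x)"
    unfolding psd_def
  proof (intro conjI allI impI)
    fix v :: "nat \<Rightarrow> real"
    have "(\<Sum>i<n. \<Sum>j<n. v i * spiked_cov 0 x i j * v j)
        = (\<Sum>i<n. \<Sum>j<n. if j = i then v i * v i else 0)"
      by (intro sum.cong) (auto simp: spiked_cov_def id_mat_def)
    also have "\<dots> = (\<Sum>i<n. v i * v i)" by simp
    also have "\<dots> \<ge> 0" by (intro sum_nonneg) simp
    finally show "(\<Sum>i<n. \<Sum>j<n. v i * spiked_cov 0 x i j * v j) \<ge> 0" .
  qed (auto simp: spiked_cov_def id_mat_def)
  have "2 * l * r < 1" using t by (simp add: lr)
  from wishart_chernoff[OF psd, of r l N "t * real N * r"] this
  have "emeasure (unspiked_wishart n N)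
      {Y \<in> space (rmat n). l * (t * real N * r) \<le> l * (\<Sum>i<n. \<Sum>j<n. x i * Y (i, j) * x j)}
    \<le> ennreal (exp (- (l * (t * real N * r))) * (1 / sqrt (1 - 2 * l * r)) ^ N)"
    by (simp add: r_def cov unspiked_wishart_def)
  also have "exp (- (l * (t * real N * r))) = exp (real N / 2 * (1 - t))"
    using r t by (simp add: l_def field_simps)
  also have "1 / sqrt (1 - 2 * l * r) = exp (ln t / 2)"
    using t by (simp add: lr real_sqrt_divide ln_sqrt[symmetric])
  also have "exp (real N / 2 * (1 - t)) * exp (ln t / 2) ^ N = exp (real N / 2 * (1 - t + ln t))"
    by (simp add: exp_of_nat_mult[symmetric] exp_add[symmetric] field_simps)
  finally show ?thesis
    using l0 by (simp add: r_def mult_le_cancel_left_neg)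
qed

text \<open>Each column contributes variance r (1 + \<beta> r) with r = |x|^2, which is at most r s.
  Bounding by \<open>s\<close> instead of the exact factor keeps the rate finite when 1 + \<beta> r
  = 0, that is, when the spike direction is degenerate.\<close>

lemma spiked_upper_tail:
  assumes psd: "psd n (spiked_cov \<beta> x)" and x: "vnorm n x > 0"
    and s: "1 + \<beta> * (vnorm n x)\<^sup>2 \<le> s" and t: "0 < s" "s < t"
  shows "emeasure (wishart n N (spiked_cov \<beta> x))
      {Y \<in> space (rmat n). t * real N * (vnorm n x)\<^sup>2 \<le> (\<Sum>i<n. \<Sum>j<n. x i * Y (i, j) * x j)}
    \<le> ennreal (exp (real N / 2 * (1 - t / s + ln (t / s))))"
proof -
  define r where "r = (vnorm n x)\<^sup>2"
  have r: "r > 0" using x by (simp add: r_def)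
  define v where "v = r + \<beta> * r\<^sup>2"
  \<comment> \<open>The optimal exponent for variance r s, given by 1 - 2 l r s = s/t.\<close>
  define l where "l = (1 / s - 1 / t) / (2 * r)"
  have st: "1 / s - 1 / t > 0" using t by (simp add: field_simps)
  have l0: "l > 0" using r st by (simp add: l_def)
  have "2 * l * v = (1 / s - 1 / t) * (1 + \<beta> * r)"
  proof -
    have "v = r * (1 + \<beta> * r)" by (simp add: v_def algebra_simps power2_eq_square)
    then show ?thesis using r by (simp add: l_def)
  qed
  also have "\<dots> \<le> (1 / s - 1 / t) * s"
    using s st by (intro mult_left_mono) (auto simp: r_def)
  also have "\<dots> = 1 - s / t" using t by (simp add: field_simps)
  finally have lv: "s / t \<le> 1 - 2 * l * v" by simp
  moreover have "s / t > 0" using t by simp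
  ultimately have "2 * l * v < 1" by linarith
  from wishart_chernoff[OF psd, of v l N "t * real N * r"] this
  have "emeasure (wishart n N (spiked_cov \<beta> x))
      {Y \<in> space (rmat n). l * (t * real N * r) \<le> l * (\<Sum>i<n. \<Sum>j<n. x i * Y (i, j) * x j)}
    \<le> ennreal (exp (- (l * (t * real N * r))) * (1 / sqrt (1 - 2 * l * v)) ^ N)"
    by (simp add: r_def v_def)
  also have "\<dots> \<le> ennreal (exp (- (l * (t * real N * r))) * sqrt (t / s) ^ N)"
  proof (intro ennreal_leI mult_left_mono power_mono)
    have "1 / sqrt (1 - 2 * l * v) \<le> 1 / sqrt (s / t)"
      using lv \<open>s / t > 0\<close> by (intro divide_left_mono real_sqrt_le_mono mult_pos_pos) auto
    then show "1 / sqrt (1 - 2 * l * v) \<le> sqrt (t / s)" by (simp add: real_sqrt_divide)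
  qed (use lv \<open>s / t > 0\<close> in auto)
  also have "exp (- (l * (t * real N * r))) = exp (real N / 2 * (1 - t / s))"
    using r t by (simp add: l_def field_simps)
  also have "sqrt (t / s) = exp (ln (t / s) / 2)"
    using t by (simp add: ln_sqrt[symmetric])
  also have "exp (real N / 2 * (1 - t / s)) * exp (ln (t / s) / 2) ^ N
      = exp (real N / 2 * (1 - t / s + ln (t / s)))"
    by (simp add: exp_of_nat_mult[symmetric] exp_add[symmetric] distrib_left)
  finally show ?thesis
    using l0 by (simp add: r_def mult.assoc)
qed

section \<open>Asymptotic rates and the choice of the threshold\<close>

text \<open>The exponent equals N (a n/N + b); the bracket tends to \<gamma> a + b < 0, and N tends
  to infinity because n/N has a finite positive limit.\<close>

lemma exp_linear_rate_tendsto_0: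
  fixes N :: "nat \<Rightarrow> nat"
  assumes \<gamma>: "\<gamma> > 0" and lim: "(\<lambda>n. real n / real (N n)) \<longlonglongrightarrow> \<gamma>" and ab: "\<gamma> * a + b < 0"
  shows "(\<lambda>n. exp (real n * a + real (N n) * b)) \<longlonglongrightarrow> 0"
proof -
  \<comment> \<open>Since division by 0 yields 0, a positive ratio forces
    \<open>N n > 0\<close>.\<close>
  have ev: "\<forall>\<^sub>F n in sequentially. real n / real (N n) > 0"
    using order_tendstoD(1)[OF lim \<gamma>] .
  have "filterlim (\<lambda>n. inverse (real n / real (N n)) * real n) at_top sequentially"
    by (rule filterlim_tendsto_pos_mult_at_top[OF tendsto_inverse[OF lim] _ filterlim_real_sequentially])
      (use \<gamma> in auto)
  moreover have "\<forall>\<^sub>F n in sequentially. inverse (real n / real (N n)) * real n = real (N n)"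
    using ev by eventually_elim (auto simp: zero_less_divide_iff)
  ultimately have N: "filterlim (\<lambda>n. real (N n)) at_top sequentially"
    by (simp cong: filterlim_cong)
  have "((\<lambda>n. real n / real (N n) * a + b) \<longlongrightarrow> \<gamma> * a + b) sequentially"
    by (intro tendsto_intros lim)
  from filterlim_tendsto_neg_mult_at_bot[OF this ab N]
  have "filterlim (\<lambda>n. (real n / real (N n) * a + b) * real (N n)) at_bot sequentially" .
  moreover have "\<forall>\<^sub>F n in sequentially.
      (real n / real (N n) * a + b) * real (N n) = real n * a + real (N n) * b"
    using ev by eventually_elim (auto simp: zero_less_divide_iff field_simps)
  ultimately have "filterlim (\<lambda>n. real n * a + real (N n) * b) at_bot sequentially"
    by (simp cong: filterlim_cong)
  then show ?thesis by (rule filterlim_compose[OF exp_at_bot])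
qed

text \<open>At t = 1 + \<beta> the function 1 - t + ln t is the left side of the hypothesis, so by
  continuity the strict inequality survives for \<open>t\<close> slightly larger. For \<beta> = -1
  the divergence of ln at 0 replaces continuity, matching the value -\<infinity> of
  \<open>elog 0\<close>.\<close>

lemma exists_threshold:
  assumes \<beta>: "-1 \<le> \<beta>" "\<beta> < 0"
    and L: "ereal (- \<beta>) + elog (1 - (- \<beta>)) < ereal L"
  shows "\<exists>t. 1 + \<beta> < t \<and> t < 1 \<and> 1 - t + ln t < L"
proof -
  have "\<forall>\<^sub>F t in at_right (1 + \<beta>). 1 - t + ln t < L"
  proof (cases "\<beta> = -1")
    case True
    have "\<forall>\<^sub>F t::real in at_right 0. ln t < L - 1"
      using ln_at_0 by (simp add: filterlim_at_bot_dense)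
    moreover have "\<forall>\<^sub>F t::real in at_right 0. 0 < t"
      by (rule eventually_at_right_less)
    ultimately have "\<forall>\<^sub>F t::real in at_right 0. 1 - t + ln t < L"
      by eventually_elim simp
    then show ?thesis using True by simp
  next
    case False
    then have "1 + \<beta> > 0" using \<beta> by simp
    then have "((\<lambda>t. 1 - t + ln t) \<longlongrightarrow> 1 - (1 + \<beta>) + ln (1 + \<beta>)) (at_right (1 + \<beta>))"
      by (intro tendsto_intros) auto
    moreover have "1 - (1 + \<beta>) + ln (1 + \<beta>) < L"
      using L False by (simp add: elog_def)
    ultimately show ?thesis by (rule order_tendstoD(2))
  qed
  moreover have "\<forall>\<^sub>F t in at_right (1 + \<beta>). t \<in> {1 + \<beta><..<1}"
    using \<beta> by (intro eventually_at_right_real) simp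
  ultimately have "\<forall>\<^sub>F t in at_right (1 + \<beta>). 1 + \<beta> < t \<and> t < 1 \<and> 1 - t + ln t < L"
    by eventually_elim auto
  then show ?thesis using eventually_happens'[OF trivial_limit_at_right_real] by blast
qed


section \<open>Atoms of the prior\<close>

text \<open>Every ball around an atom contains the atom. This transfers positive semidefiniteness,
  assumed on the support, to the atoms among the finitely many points that carry the prior.\<close>

lemma atom_in_msupport:
  assumes sets: "sets P = sets (rvec n)" and x: "x \<in> space P" and pos: "emeasure P {x} > 0"
  shows "x \<in> msupport n P"
  unfolding msupport_def
proof (intro CollectI conjI x allI impI)
  fix \<epsilon> :: real assume "\<epsilon> > 0"
  have [measurable_cong]: "sets P = sets (rvec n)" by fact
  have "{y \<in> space P. vnorm n (\<lambda>i. y i - x i) < \<epsilon>} \<in> sets P"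
    unfolding L2_set_def by measurable
  then have "emeasure P {x} \<le> emeasure P {y \<in> space P. vnorm n (\<lambda>i. y i - x i) < \<epsilon>}"
    using x \<open>\<epsilon> > 0\<close> by (intro emeasure_mono) (auto simp: L2_set_def)
  with pos show "emeasure P {y \<in> space P. vnorm n (\<lambda>i. y i - x i) < \<epsilon>} > 0"
    by (rule less_le_trans)
qed

lemma singleton_sets_rvec:
  assumes "sets P = sets (rvec n)" and "x \<in> space P"
  shows "{x} \<in> sets P"
proof -
  have "x \<in> extensional {..<n}"
    using assms(2) sets_eq_imp_space_eq[OF assms(1)] by (auto simp: space_PiM PiE_def)
  then have "{x} = PiE {..<n} (\<lambda>i. {x i})" by (simp add: PiE_singleton)
  also have "\<dots> \<in> sets (rvec n)" by (intro sets_PiM_I_finite) auto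
  finally show ?thesis using assms(1) by simp
qed

theorem theorem5p11:
  fixes \<gamma> \<beta> c :: real
    and P :: "nat \<Rightarrow> (nat \<Rightarrow> real) measure"
    and N :: "nat \<Rightarrow> nat"
  assumes "\<gamma> > 0" and "-1 \<le> \<beta>" and "\<beta> < 0"
    and "spike_prior P"
    and "\<And>n. \<exists>S \<subseteq> space (P n). finite S \<and> real (card S) \<le> c ^ n \<and> measure (P n) S = 1"
    and "\<And>n x. x \<in> msupport n (P n) \<Longrightarrow> psd n (spiked_cov \<beta> x)"
    and "(\<lambda>n. real n / real (N n)) \<longlonglongrightarrow> \<gamma>"
    and "ereal (- \<beta>) + elog (1 - (- \<beta>)) < ereal (- 2 * \<gamma> * ln c)"
  shows "\<exists>T :: nat \<Rightarrow> (nat \<times> nat \<Rightarrow> real) \<Rightarrow> bool.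
    (\<forall>n. T n \<in> measurable (rmat n) (count_space UNIV)) \<and>
    (\<lambda>n. measure (unspiked_wishart n (N n)) {Y \<in> space (rmat n). T n Y}) \<longlonglongrightarrow> 0 \<and>
    (\<lambda>n. measure (spiked_wishart n (N n) \<beta> (P n)) {Y \<in> space (rmat n). \<not> T n Y}) \<longlonglongrightarrow> 0"
proof -

  \<comment> \<open>Threshold, admissible spikes and the scan test\<close>
  obtain t where t: "1 + \<beta> < t" "t < 1" "1 - t + ln t < - 2 * \<gamma> * ln c"
    using exists_threshold[OF assms(2,3,8)] by blast
  have t0: "t > 0" using t(1) assms(2) by linarith
  \<comment> \<open>A level strictly between 1 + \<beta> and \<open>t\<close>, positive even for
    \<beta> = -1: it will bound 1 + \<beta> |x|^2 for typical spikes and still leave a gap below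
    \<open>t\<close>.\<close>
  define s where "s = (1 + \<beta> + t) / 2"
  have s: "1 + \<beta> < s" "s < t" "0 < s" using t assms(2) by (auto simp: s_def)
  \<comment> \<open>If |x| \<ge> 1 - \<delta>, then 1 + \<beta> |x|^2 \<le> 1 + \<beta> + 2 \<delta>
    \<le> s, using -\<beta> \<le> 1. The cap 1/2 keeps |x| away from 0.\<close>
  define \<delta> where "\<delta> = min (1 / 2) ((s - 1 - \<beta>) / 2)"
  have \<delta>: "\<delta> > 0" "\<delta> < 1" "2 * \<delta> \<le> s - 1 - \<beta>" using s by (auto simp: \<delta>_def min_def)
  have prior: "prob_space (P n)" "sets (P n) = sets (rvec n)" for n
    using assms(4) by (auto simp: spike_prior_def)
  define Bad where "Bad n = {x \<in> space (P n). \<bar>vnorm n x - 1\<bar> > \<delta>}" for n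
  have Bad_lim: "(\<lambda>n. measure (P n) (Bad n)) \<longlonglongrightarrow> 0"
    using assms(4) \<delta> by (simp add: spike_prior_def Bad_def)
  have Bad_sets: "Bad n \<in> sets (P n)" for n
  proof -
    have [measurable_cong]: "sets (P n) = sets (rvec n)" by (rule prior)
    show ?thesis unfolding Bad_def L2_set_def by measurable
  qed
  obtain S where S: "\<And>n. S n \<subseteq> space (P n)" "\<And>n. finite (S n)"
    "\<And>n. real (card (S n)) \<le> c ^ n" "\<And>n. measure (P n) (S n) = 1"
    using assms(5) by metis
  have Ssing: "{x} \<in> sets (P n)" if "x \<in> S n" for n x
    using singleton_sets_rvec[OF prior(2)] S(1) that by blast
  \<comment> \<open>A set of probability 1 is nonempty, so dimension 1 already gives 1 \<le> c; this
    allows writing \<open>c ^ n\<close> as \<open>exp (real n * ln c)\<close>.\<close>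
  have c: "c \<ge> 1"
  proof -
    have "S 1 \<noteq> {}" using S(4)[of 1] by auto
    then have "card (S 1) \<ge> 1" using S(2) by (simp add: Suc_leI card_gt_0_iff)
    then show ?thesis using S(3)[of 1] by simp
  qed
  \<comment> \<open>The candidates to be scanned. Atypical norms are left out, at the cost of their
    vanishing prior mass in the type II error.\<close>
  define G where "G n = S n - Bad n" for n
  have G: "finite (G n)" "real (card (G n)) \<le> c ^ n" for n
    using S(2) S(3)[of n] card_mono[OF S(2), of "G n" n] by (auto simp: G_def)
  have G_norm: "vnorm n x > 0" "1 + \<beta> * (vnorm n x)\<^sup>2 \<le> s" if "x \<in> G n" for n x
  proof -
    have a: "1 - \<delta> \<le> vnorm n x" using that S(1) by (force simp: G_def Bad_def)
    then show "vnorm n x > 0" using \<delta> by simp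
    have "1 - 2 * \<delta> \<le> (1 - \<delta>)\<^sup>2" by (simp add: power2_eq_square algebra_simps)
    also have "\<dots> \<le> (vnorm n x)\<^sup>2" using a \<delta> by (intro power_mono) auto
    finally have "\<beta> * (vnorm n x)\<^sup>2 \<le> \<beta> * (1 - 2 * \<delta>)" using assms(3) by simp
    moreover have "- \<beta> * \<delta> \<le> 1 * \<delta>" using assms(2) \<delta> by (intro mult_right_mono) auto
    ultimately show "1 + \<beta> * (vnorm n x)\<^sup>2 \<le> s" using \<delta> by (simp add: algebra_simps)
  qed
  define Q where "Q n x Y = (\<Sum>i<n. \<Sum>j<n. x i * Y (i, j) * x j)"
    for n and x :: "nat \<Rightarrow> real" and Y :: "nat \<times> nat \<Rightarrow> real"
  have Q [measurable]: "Q n x \<in> borel_measurable (rmat n)" for n x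
    unfolding Q_def by (rule quadratic_form_measurable)
  \<comment> \<open>True means that a spike is declared: since \<beta> < 0, a spike lowers the
    variance in its own direction.\<close>
  define T where "T n Y \<longleftrightarrow> (\<exists>x\<in>G n. Q n x Y \<le> t * real (N n) * (vnorm n x)\<^sup>2)" for n Y
  have T: "T n \<in> measurable (rmat n) (count_space UNIV)" for n
    unfolding T_def using G(1) by measurable

  \<comment> \<open>Type I error: union bound over at most \<open>c ^ n\<close> candidates\<close>
  have type1: "measure (unspiked_wishart n (N n)) {Y \<in> space (rmat n). T n Y}
      \<le> exp (real n * ln c + real (N n) * ((1 - t + ln t) / 2))" for n
  proof -
    let ?W = "unspiked_wishart n (N n)"
    let ?E = "\<lambda>x. {Y \<in> space (rmat n). Q n x Y \<le> t * real (N n) * (vnorm n x)\<^sup>2}"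
    interpret W: prob_space ?W unfolding unspiked_wishart_def by (rule prob_space_wishart)
    have E: "?E x \<in> sets ?W" for x
      unfolding unspiked_wishart_def sets_wishart by measurable
    have "{Y \<in> space (rmat n). T n Y} = (\<Union>x\<in>G n. ?E x)" by (auto simp: T_def)
    then have "measure ?W {Y \<in> space (rmat n). T n Y} \<le> (\<Sum>x\<in>G n. measure ?W (?E x))"
      using E G(1) by (auto intro!: W.finite_measure_subadditive_finite)
    also have "\<dots> \<le> (\<Sum>x\<in>G n. exp (real (N n) / 2 * (1 - t + ln t)))"
    proof (rule sum_mono)
      fix x assume "x \<in> G n"
      from unspiked_lower_tail[OF G_norm(1)[OF this] t0 t(2), of "N n"]
      show "measure ?W (?E x) \<le> exp (real (N n) / 2 * (1 - t + ln t))"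
        by (simp add: Q_def W.emeasure_eq_measure)
    qed
    also have "\<dots> \<le> c ^ n * exp (real (N n) / 2 * (1 - t + ln t))"
      using G(2) by (simp add: mult_right_mono)
    also have "c ^ n = exp (real n * ln c)" using c by (simp add: exp_of_nat_mult)
    also have "exp (real n * ln c) * exp (real (N n) / 2 * (1 - t + ln t))
        = exp (real n * ln c + real (N n) * ((1 - t + ln t) / 2))"
      by (simp add: exp_add)
    finally show ?thesis .
  qed
  \<comment> \<open>The rate \<gamma> ln c + (1 - t + ln t)/2 is negative exactly by the choice of
    \<open>t\<close>.\<close>
  have lim1: "(\<lambda>n. exp (real n * ln c + real (N n) * ((1 - t + ln t) / 2))) \<longlonglongrightarrow> 0"
    using t(3) by (intro exp_linear_rate_tendsto_0[OF assms(1,7)]) (simp add: field_simps)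

  \<comment> \<open>Type II error: the true spike is among the candidates\<close>
  \<comment> \<open>The rate of the spiked upper tail, negative because ln u < u - 1 for u = t/s
    \<noteq> 1.\<close>
  define \<rho> where "\<rho> = (1 - t / s + ln (t / s)) / 2"
  have \<rho>: "\<rho> < 0"
  proof -
    have "t / s > 0" "t / s \<noteq> 1" using s t0 by auto
    then have "ln (t / s) < t / s - 1"
      using ln_le_minus_one[of "t / s"] ln_eq_minus_one[of "t / s"] by linarith
    then show ?thesis by (simp add: \<rho>_def)
  qed
  have type2: "measure (spiked_wishart n (N n) \<beta> (P n)) {Y \<in> space (rmat n). \<not> T n Y}
      \<le> exp (real (N n) * \<rho>) + measure (P n) (Bad n)" for n
  proof -
    interpret P: prob_space "P n" by (rule prior)
    let ?K = "\<lambda>x. wishart n (N n) (spiked_cov \<beta> x)"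
    let ?A = "{Y \<in> space (rmat n). \<not> T n Y}"
    let ?q = "ennreal (exp (real (N n) * \<rho>))"
    have A: "?A \<in> sets (rmat n)" using T by measurable
    \<comment> \<open>Given the spike x, an atypical norm is charged the trivial bound 1. Otherwise
      x is scanned, so a missed detection forces the statistic at x itself above its
      threshold.\<close>
    have bound: "emeasure (?K x) ?A * emeasure (P n) {x}
        \<le> (?q + indicator (Bad n) x) * emeasure (P n) {x}" if x: "x \<in> S n" for x
    proof (cases "x \<in> Bad n")
      case True
      have "emeasure (?K x) ?A \<le> 1"
        by (rule prob_space.measure_le_1[OF prob_space_wishart])
      also have "\<dots> \<le> ?q + indicator (Bad n) x" using True by simp
      finally show ?thesis by (rule mult_right_mono) simp
    next
      case False
      show ?thesis
      proof (cases "emeasure (P n) {x} = 0")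
        case pos: False
        have xG: "x \<in> G n" using x False by (simp add: G_def)
        have "psd n (spiked_cov \<beta> x)"
          using x S(1) pos by (intro assms(6) atom_in_msupport prior) (auto simp: zero_less_iff_neq_zero)
        note tail = spiked_upper_tail[OF this G_norm[OF xG] s(3,2), of "N n"]
        have "emeasure (?K x) ?A \<le> emeasure (?K x)
            {Y \<in> space (rmat n). t * real (N n) * (vnorm n x)\<^sup>2 \<le> Q n x Y}"
        proof (rule emeasure_mono)
          show "?A \<subseteq> {Y \<in> space (rmat n). t * real (N n) * (vnorm n x)\<^sup>2 \<le> Q n x Y}"
            using xG by (auto simp: T_def not_le intro: less_imp_le)
        qed (unfold sets_wishart, measurable)
        also have "\<dots> \<le> ?q" using tail by (simp add: Q_def \<rho>_def)
        finally show ?thesis using False by (simp add: mult_right_mono)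
      qed simp
    qed
    have "emeasure (spiked_wishart n (N n) \<beta> (P n)) ?A
        = (\<Sum>x\<in>S n. emeasure (?K x) ?A * emeasure (P n) {x})"
      unfolding spiked_wishart_def
      by (rule emeasure_mixture_finite_support[OF prior(1) S(2,4) Ssing sets_wishart A])
    also have "\<dots> \<le> (\<Sum>x\<in>S n. (?q + indicator (Bad n) x) * emeasure (P n) {x})"
      by (rule sum_mono) (rule bound)
    \<comment> \<open>Reading the sum as an integral against the prior collects the atypical points
      into the mass of \<open>Bad n\<close>.\<close>
    also have "\<dots> = (\<integral>\<^sup>+x. ?q + indicator (Bad n) x \<partial>P n)"
      by (rule nn_integral_finite_support[OF prior(1) S(2,4) Ssing, symmetric])
    also have "\<dots> = ?q + emeasure (P n) (Bad n)"
      using Bad_sets by (subst nn_integral_add) (auto simp: P.emeasure_space_1)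
    also have "\<dots> = ennreal (exp (real (N n) * \<rho>) + measure (P n) (Bad n))"
      by (simp add: P.emeasure_eq_measure)
    finally show ?thesis unfolding measure_def[of "spiked_wishart n (N n) \<beta> (P n)"]
      by (intro enn2real_leI) auto
  qed
  \<comment> \<open>No union bound is paid here, so the rate lemma is applied with coefficient 0 for
    \<open>n\<close>.\<close>
  have "(\<lambda>n. exp (real n * 0 + real (N n) * \<rho>)) \<longlonglongrightarrow> 0"
    using \<rho> by (intro exp_linear_rate_tendsto_0[OF assms(1,7)]) simp
  from tendsto_add[OF this Bad_lim]
  have lim2: "(\<lambda>n. exp (real (N n) * \<rho>) + measure (P n) (Bad n)) \<longlonglongrightarrow> 0" by simp

  have "(\<lambda>n. measure (unspiked_wishart n (N n)) {Y \<in> space (rmat n). T n Y}) \<longlonglongrightarrow> 0"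
    by (rule tendsto_sandwich[OF _ _ tendsto_const lim1]) (rule always_eventually, rule allI, rule measure_nonneg, rule always_eventually, rule allI, rule type1)
  moreover have "(\<lambda>n. measure (spiked_wishart n (N n) \<beta> (P n)) {Y \<in> space (rmat n). \<not> T n Y}) \<longlonglongrightarrow> 0"
    by (rule tendsto_sandwich[OF _ _ tendsto_const lim2]) (rule always_eventually, rule allI, rule measure_nonneg, rule always_eventually, rule allI, rule type2)
  ultimately show ?thesis using T by blast
qed

end
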